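(* For integers $\ell,m,p$, let $\mathfrak a_{\ell,m,p}$ be the number of inversion sequences $\sigma\in\mathcal{I}_\ell(100,110)$ such that $\max(\sigma)=m$ and the value $m$ appears exactly once in $\sigma$, at position $p$. Then for all $n\geqslant 2$, $$|\mathcal{I}_n(100,110)|=\sum_{\ell=1}^{n}\sum_{m=0}^{\ell-1}\sum_{p=m+1}^{\ell}\mathfrak a_{\ell,m,p}.$$
   Context: For $n\in\mathbb N$, an inversion sequence of size $n$ is a sequence $\sigma=(\sigma_1,\dots,\sigma_n)\in\mathbb N^n$ with $\sigma_i<i$ for all $i$. An integer sequence contains a pattern $\rho$ (a finite integer sequence such as $100$ or $110$) if it has a subsequence order-isomorphic to $\rho$, and avoids $\rho$ otherwise. $\mathcal{I}_n(P)$ denotes the set of inversion sequences of size $n$ avoiding every pattern in the set $P$. $\max(\sigma)$ is the largest entry of $\sigma$. *)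

theory Defs
  imports Main "HOL-Library.Sublist"
begin

(* Lists are 0-indexed: the paper's sigma_i is "s ! (i - 1)", so sigma_i < i
   for 1 <= i <= n reads "s ! i < Suc i" for i < n. *)
definition inversion_sequence :: "nat list \<Rightarrow> bool" where
  "inversion_sequence s \<longleftrightarrow> (\<forall>i<length s. s ! i < Suc i)"

(* Both orders are linear, so preserving and reflecting < also preserves and
   reflects equality of entries. *)
definition order_isomorphic :: "'a::linorder list \<Rightarrow> 'b::linorder list \<Rightarrow> bool" where
  "order_isomorphic xs ys \<longleftrightarrow>
     length xs = length ys \<and>
     (\<forall>i<length xs. \<forall>j<length xs. xs ! i < xs ! j \<longleftrightarrow> ys ! i < ys ! j)"

definition contains_pattern :: "'a::linorder list \<Rightarrow> 'b::linorder list \<Rightarrow> bool" where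
  "contains_pattern s \<rho> \<longleftrightarrow> (\<exists>t. subseq t s \<and> order_isomorphic t \<rho>)"

definition inv_seqs_avoiding :: "nat \<Rightarrow> int list set \<Rightarrow> nat list set" where
  "inv_seqs_avoiding n P =
     {s. length s = n \<and> inversion_sequence s \<and> (\<forall>\<rho>\<in>P. \<not> contains_pattern s \<rho>)}"

(* The position p is 1-based. The last condition says that m occurs exactly once,
   at position p; it forces s to be nonempty, so Max is never applied to the
   empty set. *)
definition unique_max_count :: "nat \<Rightarrow> nat \<Rightarrow> nat \<Rightarrow> nat" where
  "unique_max_count l m p =
     card {s \<in> inv_seqs_avoiding l {[1, 0, 0], [1, 1, 0]}.
             Max (set s) = m \<and> {i \<in> {1..l}. s ! (i - 1) = m} = {p}}"

end

theory Submission
  imports Defs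
begin

text \<open>
  If the maximum of a nonempty sequence avoiding 110 occurs at least twice, then the last entry is
  this maximum. Conversely, appending a copy of the maximum to a nonempty sequence creates neither
  100 nor 110, since the last letter of these patterns is not their largest one. Hence the members of
  \<open>I_n(100,110)\<close> with repeated maximum are in bijection with \<open>I_(n-1)(100,110)\<close> for \<open>n \<ge> 2\<close>, and the
  formula follows by induction on \<open>n\<close>.
\<close>

text \<open>Removes the \<open>int\<close> pattern: two entries are equal exactly when neither is
  below the other, so only subsequences of \<open>s\<close> with a repeated letter remain. The 110
  version below works the same way.\<close>

lemma contains_100_iff:
  "contains_pattern s [1::int, 0, 0] \<longleftrightarrow> (\<exists>x y. y < x \<and> subseq [x, y, y] s)"
proof
  assume "contains_pattern s [1::int, 0, 0]"
  then obtain t where t: "subseq t s" "order_isomorphic t [1::int, 0, 0]"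
    by (auto simp: contains_pattern_def)
  then obtain x y z where [simp]: "t = [x, y, z]"
    by (auto simp: order_isomorphic_def length_Suc_conv)
  have "y < x" "y = z"
    using t(2) by (auto simp: order_isomorphic_def All_less_Suc)
  with t(1) show "\<exists>x y. y < x \<and> subseq [x, y, y] s" by auto
next
  assume "\<exists>x y. y < x \<and> subseq [x, y, y] s"
  then obtain x y where "y < x" "subseq [x, y, y] s" by auto
  then show "contains_pattern s [1::int, 0, 0]"
    unfolding contains_pattern_def
    by (intro exI[of _ "[x, y, y]"]) (auto simp: order_isomorphic_def All_less_Suc)
qed

lemma contains_110_iff:
  "contains_pattern s [1::int, 1, 0] \<longleftrightarrow> (\<exists>x y. y < x \<and> subseq [x, x, y] s)"
proof
  assume "contains_pattern s [1::int, 1, 0]"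
  then obtain t where t: "subseq t s" "order_isomorphic t [1::int, 1, 0]"
    by (auto simp: contains_pattern_def)
  then obtain x y z where [simp]: "t = [x, y, z]"
    by (auto simp: order_isomorphic_def length_Suc_conv)
  have "z < x" "y = x"
    using t(2) by (auto simp: order_isomorphic_def All_less_Suc)
  with t(1) show "\<exists>x y. y < x \<and> subseq [x, x, y] s" by auto
next
  assume "\<exists>x y. y < x \<and> subseq [x, x, y] s"
  then obtain x y where "y < x" "subseq [x, x, y] s" by auto
  then show "contains_pattern s [1::int, 1, 0]"
    unfolding contains_pattern_def
    by (intro exI[of _ "[x, x, y]"]) (auto simp: order_isomorphic_def All_less_Suc)
qed

lemma contains_pattern_append_left:
  "contains_pattern s \<rho> \<Longrightarrow> contains_pattern (s @ t) \<rho>"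
  unfolding contains_pattern_def by (meson subseq_rev_drop_many)

text \<open>At most one letter is matched in \<open>[b]\<close>, and that letter would have to be
  the final \<open>a\<close>, which differs from \<open>b\<close>.\<close>

lemma subseq_snoc_neq:
  assumes "subseq (xs @ [a]) (ys @ [b])" "a \<noteq> b"
  shows "subseq (xs @ [a]) ys"
proof -
  obtain us vs where uv: "xs @ [a] = us @ vs" "subseq us ys" "subseq vs [b]"
    using assms(1) by (auto simp: subseq_append_iff)
  from uv(3) have "vs = [] \<or> vs = [b]"
    by (cases vs) (auto split: if_splits)
  with uv assms(2) show ?thesis by auto
qed

lemma finite_inv_seqs_avoiding: "finite (inv_seqs_avoiding n P)"
proof (rule finite_subset)
  show "inv_seqs_avoiding n P \<subseteq> {s. set s \<subseteq> {..n} \<and> length s = n}"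
    by (force simp: inv_seqs_avoiding_def inversion_sequence_def in_set_conv_nth)
qed (simp add: finite_lists_length_eq)

text \<open>A new occurrence of either pattern would need the appended entry as its final letter,
  but that letter lies strictly below the first one and so cannot be the maximum.\<close>

lemma avoiding_snoc_Max:
  assumes "s \<in> inv_seqs_avoiding n {[1, 0, 0], [1, 1, 0]}" "s \<noteq> []"
  shows "s @ [Max (set s)] \<in> inv_seqs_avoiding (Suc n) {[1, 0, 0], [1, 1, 0]}"
proof -
  let ?M = "Max (set s)"
  have s: "length s = n" "inversion_sequence s"
    "\<not> contains_pattern s [1::int, 0, 0]" "\<not> contains_pattern s [1::int, 1, 0]"
    using assms by (auto simp: inv_seqs_avoiding_def)
  have M: "?M \<in> set s" using assms(2) by simp
  have "?M < n" using M s(1,2)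
    by (force simp: inversion_sequence_def in_set_conv_nth)
  then have inv: "inversion_sequence (s @ [?M])"
    using s(1,2) by (auto simp: inversion_sequence_def nth_append less_Suc_eq)
  \<comment> \<open>The middle letter is left free: \<open>z = y\<close> serves 100 and
    \<open>z = x\<close> serves 110. From \<open>y < x\<close> and \<open>x \<le> ?M\<close> follows
    \<open>y \<noteq> ?M\<close>, so the occurrence avoids the appended entry.\<close>
  have last: "subseq [x, z, y] s" if "subseq [x, z, y] (s @ [?M])" "y < x" for x y z
  proof -
    have "set [x, z, y] \<subseteq> set (s @ [?M])" using that(1)
      by (metis set_nths_subset subseq_conv_nths)
    then have "x \<le> ?M" using M by auto
    with that show ?thesis using subseq_snoc_neq[of "[x, z]" y s ?M] by auto
  qed
  have "\<not> contains_pattern (s @ [?M]) [1::int, 0, 0]" "\<not> contains_pattern (s @ [?M]) [1::int, 1, 0]"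
    using s(3,4) last unfolding contains_100_iff contains_110_iff by blast+
  with inv s(1) show ?thesis by (simp add: inv_seqs_avoiding_def)
qed

lemma avoiding_butlast:
  assumes "s @ [a] \<in> inv_seqs_avoiding (Suc n) P"
  shows "s \<in> inv_seqs_avoiding n P"
proof -
  have "s ! i < Suc i" if "i < length s" for i
    using assms that unfolding inv_seqs_avoiding_def inversion_sequence_def
    by (metis (mono_tags, lifting) less_SucI length_append_singleton mem_Collect_eq nth_append)
  then show ?thesis using assms contains_pattern_append_left[of s _ "[a]"]
    by (auto simp: inv_seqs_avoiding_def inversion_sequence_def)
qed

text \<open>Cutting \<open>s\<close> just before index \<open>j\<close> puts the first letter in the
  left piece and the second in the right piece.\<close>

lemma subseq_pair:
  assumes "i < j" "j < length s"
  shows "subseq [s ! i, s ! j] s"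
proof -
  have "s ! i \<in> set (take j s)" "s ! j \<in> set (drop j s)"
    using assms by (auto simp: in_set_conv_nth intro: exI[of _ i] exI[of _ 0])
  then have "subseq ([s ! i] @ [s ! j]) (take j s @ drop j s)"
    by (intro list_emb_append_mono) (simp_all add: subseq_singleton_left)
  then show ?thesis by simp
qed

text \<open>Positions are 1-based, to agree with the index set in
  \<open>unique_max_count\<close>.\<close>

definition max_positions :: "nat list \<Rightarrow> nat set" where
  "max_positions s = {i \<in> {1..length s}. s ! (i - 1) = Max (set s)}"

text \<open>The maximum is attained, so a set of positions that is no singleton has at least two
  elements. A smaller last entry after two maxima would complete a 110.\<close>

lemma last_eq_Max_if_repeated:
  assumes "\<not> contains_pattern (s @ [a]) [1::int, 1, 0]"
    and "\<not> (\<exists>p. max_positions (s @ [a]) = {p})"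
  shows "s \<noteq> [] \<and> a = Max (set s)"
proof -
  let ?t = "s @ [a]"
  let ?M = "Max (set ?t)"
  have "?M \<in> set ?t" by (rule Max_in) auto
  then obtain i where i: "i < length ?t" "?t ! i = ?M" by (metis in_set_conv_nth)
  then have "Suc i \<in> max_positions ?t" by (auto simp: max_positions_def)
  then obtain k where "k \<in> max_positions ?t" "k \<noteq> Suc i" using assms(2) by blast
  \<comment> \<open>Positions are at least 1, so the subtraction is not truncated and
    \<open>k \<noteq> Suc i\<close> carries over to the 0-based indices.\<close>
  then have "k - 1 < length ?t" "?t ! (k - 1) = ?M" "k - 1 \<noteq> i"
    unfolding max_positions_def by auto
  then obtain j where j: "j < length ?t" "?t ! j = ?M" "j \<noteq> i" by blast
  obtain i' j' where ij: "i' < j'" "j' < length ?t" "?t ! i' = ?M" "?t ! j' = ?M"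
    using i j by (metis linorder_neqE_nat)
  \<comment> \<open>The earlier of two occurrences cannot be the last index, so \<open>s\<close>
    itself contains the maximum of the whole list.\<close>
  have i': "i' < length s" "s ! i' = ?M" using ij by (auto simp: nth_append split: if_splits)
  have "a = ?M"
  proof (rule ccontr)
    assume neq: "a \<noteq> ?M"
    have "a \<le> ?M" by simp
    with neq have "a < ?M" by linarith
    have j': "j' < length s" "s ! j' = ?M" using ij neq
      by (auto simp: nth_append less_Suc_eq split: if_splits)
    have "subseq [?M, ?M] s" using subseq_pair[OF ij(1) j'(1)] i' j' by simp
    then have "subseq ([?M, ?M] @ [a]) ?t" by (intro list_emb_append_mono) auto
    with \<open>a < ?M\<close> assms(1) show False unfolding contains_110_iff by auto
  qed
  moreover have "?M \<in> set s" using i' by (metis nth_mem)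
  ultimately have "a \<in> set s" by simp
  then have "s \<noteq> []" "Max (set s) = ?M" by (auto simp: insert_absorb)
  with \<open>a = ?M\<close> show ?thesis by metis
qed

text \<open>The appended copy joins an occurrence already in \<open>s\<close>. This separates the
  two classes counted in \<open>card_avoiding_Suc\<close>.\<close>

lemma max_positions_snoc_Max:
  assumes "s \<noteq> []"
  shows "max_positions (s @ [Max (set s)]) \<noteq> {p}"
proof
  let ?t = "s @ [Max (set s)]"
  assume *: "max_positions ?t = {p}"
  have M: "Max (set ?t) = Max (set s)" "Max (set s) \<in> set s"
    using assms by (simp_all add: insert_absorb)
  obtain i where i: "i < length s" "s ! i = Max (set s)" by (metis M(2) in_set_conv_nth)
  have "Suc i \<in> max_positions ?t" "Suc (length s) \<in> max_positions ?t"
    using i M(1) by (auto simp: max_positions_def nth_append)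
  with * i(1) show False by auto
qed

definition unique_max_seqs :: "nat \<Rightarrow> nat list set" where
  "unique_max_seqs n = {s \<in> inv_seqs_avoiding n {[1, 0, 0], [1, 1, 0]}. \<exists>p. max_positions s = {p}}"

text \<open>Splits by whether the maximum is repeated or unique. The bound \<open>n \<ge> 1\<close>
  makes every shorter sequence nonempty; at \<open>n = 0\<close> the equation would read 1 = 1 +
  1.\<close>

lemma card_avoiding_Suc:
  assumes "n \<ge> 1"
  shows "card (inv_seqs_avoiding (Suc n) {[1, 0, 0], [1, 1, 0]}) =
    card (inv_seqs_avoiding n {[1, 0, 0], [1, 1, 0]}) + card (unique_max_seqs (Suc n))"
proof -
  let ?I = "\<lambda>n. inv_seqs_avoiding n {[1, 0, 0], [1, 1, 0]}"
  let ?f = "\<lambda>s. s @ [Max (set s)]"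
  have ne: "s \<noteq> []" if "s \<in> ?I n" for s
    using that assms by (auto simp: inv_seqs_avoiding_def)
  have "?I (Suc n) = ?f ` ?I n \<union> unique_max_seqs (Suc n)"
  proof (intro equalityI subsetI)
    fix t assume t: "t \<in> ?I (Suc n)"
    then have "t \<noteq> []" by (auto simp: inv_seqs_avoiding_def)
    then obtain s a where sa: "t = s @ [a]" by (metis rev_exhaust)
    show "t \<in> ?f ` ?I n \<union> unique_max_seqs (Suc n)"
    proof (cases "\<exists>p. max_positions t = {p}")
      case False
      with t have "a = Max (set s)"
        using last_eq_Max_if_repeated[of s a] by (auto simp: sa inv_seqs_avoiding_def)
      then show ?thesis using avoiding_butlast t sa by blast
    qed (use t in \<open>auto simp: unique_max_seqs_def\<close>)
  next
    fix t assume "t \<in> ?f ` ?I n \<union> unique_max_seqs (Suc n)"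
    then show "t \<in> ?I (Suc n)" using avoiding_snoc_Max ne by (auto simp: unique_max_seqs_def)
  qed
  moreover have "?f ` ?I n \<inter> unique_max_seqs (Suc n) = {}"
    using max_positions_snoc_Max ne by (auto simp: unique_max_seqs_def)
  moreover have "card (?f ` ?I n) = card (?I n)"
    by (intro card_image inj_onI) simp
  moreover have "finite (unique_max_seqs (Suc n))"
    by (simp add: unique_max_seqs_def finite_inv_seqs_avoiding)
  ultimately show ?thesis
    by (simp add: card_Un_disjoint finite_inv_seqs_avoiding)
qed

text \<open>A sequence determines its maximum \<open>m\<close> and the position \<open>p\<close> of
  that maximum, so the sets for different pairs are disjoint and their cardinalities add up.\<close>

lemma card_unique_max_seqs:
  "card (unique_max_seqs l) = (\<Sum>m = 0..l - 1. \<Sum>p = m + 1..l. unique_max_count l m p)"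
proof -
  let ?A = "\<lambda>m p. {s \<in> inv_seqs_avoiding l {[1, 0, 0], [1, 1, 0]}.
             Max (set s) = m \<and> {i \<in> {1..l}. s ! (i - 1) = m} = {p}}"
  let ?B = "\<lambda>(m, p). ?A m p"
  have union: "unique_max_seqs l = \<Union> (?B ` (SIGMA m:{0..l - 1}. {m + 1..l}))"
  proof (intro equalityI subsetI)
    fix s assume s: "s \<in> unique_max_seqs l"
    then obtain p where p: "max_positions s = {p}" and len: "length s = l"
      and inv: "inversion_sequence s" by (auto simp: unique_max_seqs_def inv_seqs_avoiding_def)
    have "p \<in> max_positions s" using p by simp
    then have p': "1 \<le> p" "p \<le> l" "s ! (p - 1) = Max (set s)"
      using len by (auto simp: max_positions_def)
    \<comment> \<open>The inversion bound at 1-based position \<open>p\<close> gives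
      \<open>m < p\<close>; this is why \<open>p\<close> starts at \<open>m + 1\<close>, and with
      \<open>p \<le> l\<close> it gives \<open>m \<le> l - 1\<close>.\<close>
    have "s ! (p - 1) < Suc (p - 1)"
      using inv[unfolded inversion_sequence_def, rule_format, of "p - 1"] p'(1,2) len by linarith
    then have "Max (set s) < p" using p' by linarith
    with p'(2) have "(Max (set s), p) \<in> (SIGMA m:{0..l - 1}. {m + 1..l})"
      by auto
    moreover have "s \<in> ?B (Max (set s), p)" using s p len
      by (simp add: unique_max_seqs_def max_positions_def)
    ultimately show "s \<in> \<Union> (?B ` (SIGMA m:{0..l - 1}. {m + 1..l}))" by blast
  next
    fix s assume "s \<in> \<Union> (?B ` (SIGMA m:{0..l - 1}. {m + 1..l}))"
    then show "s \<in> unique_max_seqs l"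
      by (auto simp: unique_max_seqs_def max_positions_def inv_seqs_avoiding_def)
  qed
  have "card (unique_max_seqs l) = (\<Sum>x\<in>(SIGMA m:{0..l - 1}. {m + 1..l}). card (?B x))"
    unfolding union by (rule card_UN_disjoint) (auto simp: finite_inv_seqs_avoiding)
  also have "\<dots> = (\<Sum>(m, p)\<in>(SIGMA m:{0..l - 1}. {m + 1..l}). unique_max_count l m p)"
    unfolding unique_max_count_def by (intro sum.cong refl) (simp only: split_paired_all prod.case)
  also have "\<dots> = (\<Sum>m = 0..l - 1. \<Sum>p = m + 1..l. unique_max_count l m p)"
    by (rule sum.Sigma[symmetric]) simp_all
  finally show ?thesis .
qed

lemma avoiding_one: "inv_seqs_avoiding 1 {[1, 0, 0], [1, 1, 0]} = {[0]}"
proof (intro equalityI subsetI)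
  fix s assume "s \<in> inv_seqs_avoiding 1 {[1, 0, 0], [1, 1, 0]}"
  then show "s \<in> {[0]}"
    by (auto simp: inv_seqs_avoiding_def inversion_sequence_def length_Suc_conv)
next
  fix s :: "nat list" assume "s \<in> {[0]}"
  then show "s \<in> inv_seqs_avoiding 1 {[1, 0, 0], [1, 1, 0]}"
    by (auto simp: inv_seqs_avoiding_def inversion_sequence_def contains_100_iff contains_110_iff
        split: if_splits)
qed

text \<open>Unrolls \<open>card_avoiding_Suc\<close> down to size 1, where the only sequence
  \<open>[0]\<close> has a unique maximum and accounts for the first summand.\<close>

lemma card_avoiding_eq_sum:
  assumes "n \<ge> 1"
  shows "card (inv_seqs_avoiding n {[1, 0, 0], [1, 1, 0]}) = (\<Sum>l = 1..n. card (unique_max_seqs l))"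
  using assms
proof (induction n rule: dec_induct)
  case base
  have "max_positions [0] = {1}" by (auto simp: max_positions_def)
  then have "unique_max_seqs 1 = {[0]}" unfolding unique_max_seqs_def avoiding_one by auto
  then show ?case unfolding avoiding_one by simp
next
  case (step n)
  then show ?case by (simp add: card_avoiding_Suc)
qed

theorem theorem6:
  fixes n :: nat
  assumes "n \<ge> 2"
  shows "card (inv_seqs_avoiding n {[1, 0, 0], [1, 1, 0]}) =
    (\<Sum>l = 1..n. \<Sum>m = 0..l - 1. \<Sum>p = m + 1..l. unique_max_count l m p)"
proof -
  have "card (inv_seqs_avoiding n {[1, 0, 0], [1, 1, 0]}) = (\<Sum>l = 1..n. card (unique_max_seqs l))"
    using assms by (intro card_avoiding_eq_sum) simp
  also have "\<dots> = (\<Sum>l = 1..n. \<Sum>m = 0..l - 1. \<Sum>p = m + 1..l. unique_max_count l m p)"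
    by (intro sum.cong refl card_unique_max_seqs)
  finally show ?thesis .
qed

end
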